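(* Let $0<p,q<1$ and $\varepsilon_m=m^{-p}$ for integers $m\ge2$. For each $m$ let $\pi_1,\dots,\pi_m\in(0,1]$ (possibly depending on $m$), consider the hypotheses $H_0$ and $H_1^{(\mathrm{mix})}$ defined in the context, and let $s=\sum_{t=1}^m\zeta_t$. The sum test with critical value $c'$ rejects $H_0$ if and only if $s\le c'$. (1) If $q+p<1/2$ and, for every $m$, $\pi_t\le1-m^{-q}$ for all $t=1,\dots,m$, then for the sum test with critical value $c':=\mathbb{E}_0 s-m^{1-(p+q)}/4$, the sum of type I and type II error probabilities tends to $0$ as $m\to\infty$. (2) If $q+p>1/2$ and, for every $m$, $\pi_t\ge1-m^{-q}$ for all $t=1,\dots,m$, then for the sum test with any critical values $c'=c'_m$ satisfying $\mathbb{E}_1 s\le c'\le\mathbb{E}_0 s$, the power of the test is bounded away from $1$ as $m\to\infty$, i.e. $\limsup_{m\to\infty}\mathbb{P}_1(s\le c'_m)<1$.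
   Context: Hypotheses. For each $m$ one observes $\zeta_1,\dots,\zeta_m\in[0,1]$. Under $H_0$, $\zeta_1,\dots,\zeta_m$ are i.i.d. $U[0,1]$. Under $H_1^{(\mathrm{mix})}$, $\zeta_1,\dots,\zeta_m$ are independent and $\zeta_t\sim(1-\varepsilon_m)U[0,1]+\varepsilon_m U[0,\pi_t]$ (a mixture distribution), where $\pi_t\in(0,1]$ are given numbers. (In the watermarking application $\pi_t=P_{t,\mathcal{G}_t}=\sum_{w\in\mathcal{G}_t}P_{t,w}$ is the total next-token probability of the green list $\mathcal{G}_t$ at step $t$; one conditions on these quantities.) $\mathbb{P}_0,\mathbb{E}_0$ and $\mathbb{P}_1,\mathbb{E}_1$ denote probability and expectation under $H_0$ and $H_1^{(\mathrm{mix})}$ respectively. Type I error is the probability under $H_0$ of rejecting $H_0$; type II error is the probability under $H_1^{(\mathrm{mix})}$ of not rejecting $H_0$; power is one minus the type II error. *)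

theory Defs
  imports "HOL-Probability.Probability"
begin

abbreviation uniform_on :: "real \<Rightarrow> real measure" where
  "uniform_on a \<equiv> uniform_measure lborel {0..a}"

definition mixture :: "real \<Rightarrow> 'a measure \<Rightarrow> 'a measure \<Rightarrow> 'a measure" where
  "mixture e M N = measure_of (space M) (sets M)
     (\<lambda>A. ennreal (1 - e) * emeasure M A + ennreal e * emeasure N A)"

lemma space_mixture [simp]: "space (mixture e M N) = space M"
  and sets_mixture [simp, measurable_cong]: "sets (mixture e M N) = sets M"
  by (simp_all add: mixture_def)

text \<open>The set function given to \<^const>\<open>measure_of\<close> is a measure, so \<^const>\<open>mixture\<close>
  does not degenerate to the null measure.\<close>

lemma emeasure_mixture:
  assumes "sets N = sets M" and A: "A \<in> sets M"
  shows "emeasure (mixture e M N) A = ennreal (1 - e) * emeasure M A + ennreal e * emeasure N A"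
  unfolding mixture_def
proof (rule emeasure_measure_of_sigma)
  show "sigma_algebra (space M) (sets M)" ..
  show "positive (sets M) (\<lambda>A. ennreal (1 - e) * emeasure M A + ennreal e * emeasure N A)"
    by (simp add: positive_def)
  show "countably_additive (sets M)
      (\<lambda>A. ennreal (1 - e) * emeasure M A + ennreal e * emeasure N A)"
  proof (rule countably_additiveI)
    fix F :: "nat \<Rightarrow> 'a set"
    assume F: "range F \<subseteq> sets M" "disjoint_family F"
    with assms have "range F \<subseteq> sets N" by simp
    with F show "(\<Sum>i. ennreal (1 - e) * emeasure M (F i) + ennreal e * emeasure N (F i)) =
        ennreal (1 - e) * emeasure M (\<Union>i. F i) + ennreal e * emeasure N (\<Union>i. F i)"
      by (simp add: suminf_add[symmetric] suminf_emeasure)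
  qed
qed (rule A)

text \<open>Both hypotheses concern the law of the observations \<open>\<zeta> 1, \<dots>, \<zeta> m\<close> under a probability
  measure \<open>P\<close> on an arbitrary sample space; the values lie in \<open>[0,1]\<close> almost surely.\<close>

definition null_hypothesis ::
  "nat \<Rightarrow> (nat \<Rightarrow> 'a \<Rightarrow> real) \<Rightarrow> 'a measure \<Rightarrow> bool" where
  "null_hypothesis m \<zeta> P \<longleftrightarrow>
     prob_space P \<and>
     prob_space.indep_vars P (\<lambda>_. borel) \<zeta> {1..m} \<and>
     (\<forall>t\<in>{1..m}. distr P borel (\<zeta> t) = uniform_on 1)"

definition mixture_hypothesis ::
  "nat \<Rightarrow> real \<Rightarrow> (nat \<Rightarrow> real) \<Rightarrow> (nat \<Rightarrow> 'a \<Rightarrow> real) \<Rightarrow> 'a measure \<Rightarrow> bool" where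
  "mixture_hypothesis m e \<pi> \<zeta> P \<longleftrightarrow>
     prob_space P \<and>
     prob_space.indep_vars P (\<lambda>_. borel) \<zeta> {1..m} \<and>
     (\<forall>t\<in>{1..m}. distr P borel (\<zeta> t) = mixture e (uniform_on 1) (uniform_on (\<pi> t)))"

definition sum_stat :: "nat \<Rightarrow> (nat \<Rightarrow> 'a \<Rightarrow> real) \<Rightarrow> 'a \<Rightarrow> real" where
  "sum_stat m \<zeta> \<omega> = (\<Sum>t=1..m. \<zeta> t \<omega>)"

definition sum_test_rejects :: "nat \<Rightarrow> (nat \<Rightarrow> 'a \<Rightarrow> real) \<Rightarrow> real \<Rightarrow> 'a \<Rightarrow> bool" where
  "sum_test_rejects m \<zeta> c \<omega> \<longleftrightarrow> sum_stat m \<zeta> \<omega> \<le> c"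

text \<open>For a test with rejection rule \<open>R\<close>; the first argument is the probability measure
  under \<open>H\<^sub>0\<close> for the type I error, and under \<open>H\<^sub>1\<close> for the type II error and the power.\<close>

definition type_I_error :: "'a measure \<Rightarrow> ('a \<Rightarrow> bool) \<Rightarrow> real" where
  "type_I_error P R = measure P {\<omega> \<in> space P. R \<omega>}"

definition type_II_error :: "'a measure \<Rightarrow> ('a \<Rightarrow> bool) \<Rightarrow> real" where
  "type_II_error P R = measure P {\<omega> \<in> space P. \<not> R \<omega>}"

definition test_power :: "'a measure \<Rightarrow> ('a \<Rightarrow> bool) \<Rightarrow> real" where
  "test_power P R = 1 - type_II_error P R"

lemma test_power_sum_test:
  assumes "mixture_hypothesis m e \<pi> \<zeta> P"
  shows "test_power P (sum_test_rejects m \<zeta> c) = measure P {\<omega> \<in> space P. sum_stat m \<zeta> \<omega> \<le> c}"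
proof -
  interpret prob_space P using assms by (simp add: mixture_hypothesis_def)
  have "\<zeta> t \<in> borel_measurable P" if "t \<in> {1..m}" for t
    using assms that by (auto simp: mixture_hypothesis_def indep_vars_def)
  then have "sum_stat m \<zeta> \<in> borel_measurable P"
    unfolding sum_stat_def[abs_def] by (intro borel_measurable_sum)
  then have "{\<omega> \<in> space P. sum_stat m \<zeta> \<omega> \<le> c} \<in> events" by measurable
  from prob_neg[OF this] show ?thesis
    by (simp add: test_power_def type_II_error_def sum_test_rejects_def)
qed

end

theory Submission
  imports Defs "HOL-Real_Asymp.Real_Asymp"
begin

text \<open>Under either hypothesis the statistic \<open>s\<close> is a sum of \<open>m\<close> independent \<open>[0,1]\<close>-valued variables,
  so its variance is at most \<open>m\<close>, and \<open>E\<^sub>0 s - E\<^sub>1 s = \<Sum>t. \<epsilon> (1 - \<pi> t) / 2\<close> is at least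
  (in part 1) or at most (in part 2) \<open>m powr (1 - (p + q)) / 2\<close>. If \<open>p + q < 1/2\<close>
  this gap dominates the standard deviation and Chebyshev's inequality bounds both errors.
  If \<open>p + q > 1/2\<close> the gap is \<open>o(\<surd>m)\<close>, while the centred statistic exceeds a fixed multiple of
  \<open>\<surd>m\<close> with probability bounded below. No central limit theorem is needed for the latter: it
  follows from a variance of order \<open>m\<close> and a fourth moment of order \<open>m\<^sup>2\<close>.\<close>

section \<open>Density, support and moments of the uniform mixture\<close>

text \<open>Each uniform component is Lebesgue measure restricted to an interval and rescaled by its
  length. A density with respect to \<open>lborel\<close> reduces both the almost sure bounds and
  the moments below to integrals over intervals.\<close>

lemma mixture_uniform_eq_density:
  assumes e: "0 \<le> e" "e \<le> 1" and a: "0 < a"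
  shows "mixture e (uniform_on 1) (uniform_on a) =
    density lborel (\<lambda>x. ennreal ((1 - e) * indicator {0..1} x + e / a * indicator {0..a} x))"
    (is "_ = density lborel (\<lambda>x. ennreal (?f x))")
proof (rule measure_eqI)
  fix A assume "A \<in> sets (mixture e (uniform_on 1) (uniform_on a))"
  then have [measurable]: "A \<in> sets borel" by simp
  have split: "ennreal (?f x) * indicator A x =
      ennreal (1 - e) * indicator ({0..1} \<inter> A) x + ennreal (e / a) * indicator ({0..a} \<inter> A) x" for x
    using e a by (auto simp: indicator_def ennreal_plus)
  have "emeasure (density lborel (\<lambda>x. ennreal (?f x))) A =
      ennreal (1 - e) * emeasure lborel ({0..1} \<inter> A) + ennreal (e / a) * emeasure lborel ({0..a} \<inter> A)"
    by (subst emeasure_density) (simp_all only: split, simp_all add: nn_integral_add nn_integral_cmult)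
  also have "\<dots> = emeasure (mixture e (uniform_on 1) (uniform_on a)) A"
    using e a by (simp add: emeasure_mixture divide_ennreal[symmetric]
      ennreal_times_divide ennreal_divide_times divide_ennreal_def[of _ 1])
  finally show "emeasure (mixture e (uniform_on 1) (uniform_on a)) A =
      emeasure (density lborel (\<lambda>x. ennreal (?f x))) A" by simp
qed simp

lemma mixture_uniform_0: "mixture 0 (uniform_on 1) (uniform_on 1) = uniform_on 1"
  by (rule measure_eqI) (simp_all add: emeasure_mixture)

lemma has_bochner_integral_power_mixture:
  fixes a e :: real
  assumes e: "0 \<le> e" "e \<le> 1" and a: "0 < a"
  shows "has_bochner_integral (mixture e (uniform_on 1) (uniform_on a)) (\<lambda>x. x ^ n)
    ((1 - e) / real (Suc n) + e * a ^ n / real (Suc n))"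
proof -
  have unif: "has_bochner_integral lborel (\<lambda>x. x ^ n * indicator {0..b} x) (b ^ Suc n / real (Suc n))"
    if "0 < b" for b :: real
  proof -
    have "has_bochner_integral lborel (\<lambda>x. x ^ n * indicator {0..b} x)
        (b ^ Suc n / real (Suc n) - 0 ^ Suc n / real (Suc n))"
    proof (rule has_bochner_integral_FTC_Icc_real)
      show "((\<lambda>x. x ^ Suc n / real (Suc n)) has_real_derivative x ^ n) (at x)" for x
        by (rule derivative_eq_intros | simp del: of_nat_Suc)+
    qed (use that in auto)
    then show ?thesis by simp
  qed
  show ?thesis
    unfolding mixture_uniform_eq_density[OF e a]
  proof (rule has_bochner_integral_density)
    \<comment> \<open>The factor \<open>1 / a\<close> in the density cancels one power of
      \<open>a ^ Suc n\<close>, which leaves the \<open>a ^ n\<close> of the claim.\<close>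
    have "has_bochner_integral lborel
        (\<lambda>x. (1 - e) * (x ^ n * indicator {0..1} x) + e / a * (x ^ n * indicator {0..a} x))
        ((1 - e) * (1 ^ Suc n / real (Suc n)) + e / a * (a ^ Suc n / real (Suc n)))"
      by (intro has_bochner_integral_add has_bochner_integral_mult_right unif) (use a in auto)
    then show "has_bochner_integral lborel
        (\<lambda>x. ((1 - e) * indicator {0..1} x + e / a * indicator {0..a} x) *\<^sub>R x ^ n)
        ((1 - e) / real (Suc n) + e * a ^ n / real (Suc n))"
      using a by (simp add: algebra_simps del: of_nat_Suc)
  qed (use e a in auto)
qed

lemma AE_mixture_uniform:
  assumes e: "0 \<le> e" "e \<le> 1" and a: "0 < a" "a \<le> 1"
  shows "AE x in mixture e (uniform_on 1) (uniform_on a). 0 \<le> x \<and> x \<le> 1"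
  unfolding mixture_uniform_eq_density[OF e a(1)]
  using a by (subst AE_density) (auto simp: indicator_def)

section \<open>Second and fourth moments of sums of independent centred bounded variables\<close>

text \<open>Adding a term Y independent of the sum S, mixed moments factor and every product
  containing E Y or E S vanishes. With n terms in S, the fourth moment becomes E Y^4 + 6 E Y^2 E S^2
  + E S^4, at most 1 + 6 n + 3 n^2 <= 3 (n + 1)^2. The claims share one induction because the fourth
  moment needs the bound on E S^2, and the almost sure bound makes all powers of S
  integrable.\<close>

lemma (in prob_space) indep_vars_centred_sum_moments:
  fixes Y :: "'b \<Rightarrow> 'a \<Rightarrow> real"
  assumes "finite I" "indep_vars (\<lambda>_. borel) Y I"
    and "\<And>i. i \<in> I \<Longrightarrow> expectation (Y i) = 0"
    and "\<And>i. i \<in> I \<Longrightarrow> AE \<omega> in M. \<bar>Y i \<omega>\<bar> \<le> 1"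
  shows "(AE \<omega> in M. \<bar>\<Sum>i\<in>I. Y i \<omega>\<bar> \<le> card I) \<and>
    expectation (\<lambda>\<omega>. \<Sum>i\<in>I. Y i \<omega>) = 0 \<and>
    expectation (\<lambda>\<omega>. (\<Sum>i\<in>I. Y i \<omega>)\<^sup>2) = (\<Sum>i\<in>I. expectation (\<lambda>\<omega>. (Y i \<omega>)\<^sup>2)) \<and>
    expectation (\<lambda>\<omega>. (\<Sum>i\<in>I. Y i \<omega>)\<^sup>2) \<le> card I \<and>
    expectation (\<lambda>\<omega>. (\<Sum>i\<in>I. Y i \<omega>) ^ 4) \<le> 3 * (real (card I))\<^sup>2"
  using assms
proof (induction I rule: finite_induct)
  case empty
  then show ?case by simp
next
  case (insert j I)
  let ?S = "\<lambda>\<omega>. \<Sum>i\<in>I. Y i \<omega>"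
  have "indep_vars (\<lambda>_. borel) Y I" using insert.prems(1) by (rule indep_vars_subset) auto
  from insert.IH[OF this] insert.prems
  have bS: "AE \<omega> in M. \<bar>?S \<omega>\<bar> \<le> card I" and S1: "expectation ?S = 0"
    and S2: "expectation (\<lambda>\<omega>. (?S \<omega>)\<^sup>2) = (\<Sum>i\<in>I. expectation (\<lambda>\<omega>. (Y i \<omega>)\<^sup>2))"
    and S2_le: "expectation (\<lambda>\<omega>. (?S \<omega>)\<^sup>2) \<le> card I"
    and S4: "expectation (\<lambda>\<omega>. (?S \<omega>) ^ 4) \<le> 3 * (real (card I))\<^sup>2" by auto
  have [measurable]: "random_variable borel (Y i)" if "i \<in> insert j I" for i
    using insert.prems(1) that by (auto simp: indep_vars_def)
  have bY: "AE \<omega> in M. \<bar>Y i \<omega>\<bar> \<le> 1" if "i \<in> insert j I" for i using insert.prems(3) that .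
  have intS: "integrable M (\<lambda>\<omega>. (?S \<omega>) ^ k)" for k
    by (rule integrable_const_bound[where B="real (card I) ^ k"], use bS in eventually_elim)
       (auto simp: power_abs intro!: power_mono)
  have intY: "integrable M (\<lambda>\<omega>. (Y i \<omega>) ^ k)" if "i \<in> insert j I" for i k
    using that by (intro integrable_const_bound[where B=1], use bY[OF that] in eventually_elim)
       (auto simp: power_abs power_le_one)
  have ind: "indep_var borel (\<lambda>\<omega>. Y j \<omega> ^ k) borel (\<lambda>\<omega>. (?S \<omega>) ^ l)" for k l
    using indep_var_compose[OF indep_vars_sum[OF insert.hyps(1,2) insert.prems(1)],
        of "\<lambda>x. x ^ k" borel "\<lambda>x. x ^ l" borel] by (simp add: comp_def)
  have mult: "expectation (\<lambda>\<omega>. Y j \<omega> ^ k * (?S \<omega>) ^ l) = expectation (\<lambda>\<omega>. Y j \<omega> ^ k) * expectation (\<lambda>\<omega>. ?S \<omega> ^ l)"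
    and intM: "integrable M (\<lambda>\<omega>. Y j \<omega> ^ k * (?S \<omega>) ^ l)" for k l
    using indep_var_lebesgue_integral[OF ind intY intS] indep_var_integrable[OF ind intY intS] by auto
  have Y1: "expectation (Y j) = 0" using insert.prems(2) by simp
  have le1: "expectation (\<lambda>\<omega>. (Y i \<omega>) ^ k) \<le> 1" if "i \<in> insert j I" for i k
  proof -
    have "expectation (\<lambda>\<omega>. (Y i \<omega>) ^ k) \<le> expectation (\<lambda>\<omega>. 1)"
    proof (rule integral_mono_AE)
      show "AE \<omega> in M. (Y i \<omega>) ^ k \<le> 1"
        using bY[OF that]
      proof eventually_elim
        case (elim \<omega>)
        have "(Y i \<omega>) ^ k \<le> \<bar>Y i \<omega>\<bar> ^ k" by (metis abs_ge_self power_abs)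
        then show ?case using elim power_le_one[of "\<bar>Y i \<omega>\<bar>" k] by simp
      qed
    qed (use intY[OF that] in auto)
    then show ?thesis by (simp add: prob_space)
  qed
  have nn: "0 \<le> expectation (\<lambda>\<omega>. (?S \<omega>)\<^sup>2)" "0 \<le> expectation (\<lambda>\<omega>. (Y j \<omega>)\<^sup>2)" by auto
  \<comment> \<open>First powers are written as \<open>^ 1\<close> so that every mixed term has the
    shape covered by \<open>mult\<close> and \<open>intM\<close>.\<close>
  have e2: "(Y j \<omega> + ?S \<omega>)\<^sup>2 = Y j \<omega> ^ 2 + 2 * (Y j \<omega> ^ 1 * ?S \<omega> ^ 1) + ?S \<omega> ^ 2" for \<omega>
    by (simp add: power2_eq_square algebra_simps)
  have e4: "(Y j \<omega> + ?S \<omega>) ^ 4 = Y j \<omega> ^ 4 + 4 * (Y j \<omega> ^ 3 * ?S \<omega> ^ 1) + 6 * (Y j \<omega> ^ 2 * ?S \<omega> ^ 2)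
      + 4 * (Y j \<omega> ^ 1 * ?S \<omega> ^ 3) + ?S \<omega> ^ 4" for \<omega>
    by (simp add: numeral_eq_Suc algebra_simps)
  have T2: "expectation (\<lambda>\<omega>. (Y j \<omega> + ?S \<omega>)\<^sup>2) =
      expectation (\<lambda>\<omega>. Y j \<omega> ^ 2) + expectation (\<lambda>\<omega>. ?S \<omega> ^ 2)"
    unfolding e2 using intM[of 1 1] intY[of j 2] intS[of 2] mult[of 1 1] Y1 by simp
  have T4: "expectation (\<lambda>\<omega>. (Y j \<omega> + ?S \<omega>) ^ 4) = expectation (\<lambda>\<omega>. Y j \<omega> ^ 4)
      + 6 * (expectation (\<lambda>\<omega>. Y j \<omega> ^ 2) * expectation (\<lambda>\<omega>. ?S \<omega> ^ 2)) + expectation (\<lambda>\<omega>. ?S \<omega> ^ 4)"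
    unfolding e4 using intM[of 3 1] intM[of 2 2] intM[of 1 3] intY[of j 4] intS[of 4]
      mult[of 3 1] mult[of 2 2] mult[of 1 3] Y1 S1 by simp
  have cross: "expectation (\<lambda>\<omega>. Y j \<omega> ^ 2) * expectation (\<lambda>\<omega>. ?S \<omega> ^ 2) \<le> 1 * real (card I)"
    using le1[of j 2] S2_le nn by (intro mult_mono) auto
  have ins: "(\<Sum>i\<in>insert j I. Y i \<omega>) = Y j \<omega> + ?S \<omega>" for \<omega>
    using insert.hyps by simp
  have card: "real (card (insert j I)) = real (card I) + 1"
    using insert.hyps by simp
  show ?case
    unfolding ins card
  proof (intro conjI)
    show "AE \<omega> in M. \<bar>Y j \<omega> + ?S \<omega>\<bar> \<le> real (card I) + 1"
      using bS bY[of j, simplified] by eventually_elim auto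
    show "expectation (\<lambda>\<omega>. Y j \<omega> + ?S \<omega>) = 0"
      using Y1 S1 intS[of 1] intY[of j 1] by simp
    show "expectation (\<lambda>\<omega>. (Y j \<omega> + ?S \<omega>)\<^sup>2) = (\<Sum>i\<in>insert j I. expectation (\<lambda>\<omega>. (Y i \<omega>)\<^sup>2))"
      using insert.hyps by (simp add: T2 S2)
    show "expectation (\<lambda>\<omega>. (Y j \<omega> + ?S \<omega>)\<^sup>2) \<le> real (card I) + 1"
      unfolding T2 using S2_le le1[of j 2] by simp
    have "expectation (\<lambda>\<omega>. (Y j \<omega> + ?S \<omega>) ^ 4) \<le> 1 + 6 * (1 * real (card I)) + 3 * (real (card I))\<^sup>2"
      unfolding T4 by (intro add_mono mult_left_mono cross S4 le1) auto
    also have "\<dots> \<le> 3 * (real (card I) + 1)\<^sup>2"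
      by (simp add: power2_eq_square algebra_simps)
    finally show "expectation (\<lambda>\<omega>. (Y j \<omega> + ?S \<omega>) ^ 4) \<le> 3 * (real (card I) + 1)\<^sup>2" .
  qed
qed

section \<open>A lower bound for the upper tail of a centred sum\<close>

text \<open>Taking expectations in this inequality with \<open>u\<close> a rescaled centred variable kills the linear term,
  so that its second and fourth moments alone bound the upper tail from below.\<close>

lemma quartic_le_indicator:
  fixes u d :: real
  assumes d: "0 \<le> d" "d \<le> 1"
  shows "u + u\<^sup>2 - u ^ 4 \<le> 2 * indicator {x. d < x} u + 2 * d"
proof -
  \<comment> \<open>Where the indicator is 1, the constant 2 bounds the left side. For negative u
    the left side is nonpositive, and on [0, d] both u and u^2 are at most d.\<close>
  consider "d < u" | "u < 0" | "0 \<le> u" "u \<le> d" by linarith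
  then show ?thesis
  proof cases
    case 1
    \<comment> \<open>A sum-of-squares certificate that the quartic never exceeds 2, valid for all
      real u.\<close>
    have "2 - (u + u\<^sup>2 - u ^ 4) = (u\<^sup>2 - 1)\<^sup>2 + (u - 1 / 2)\<^sup>2 + 3 / 4"
      by (simp add: power2_eq_square power4_eq_xxxx algebra_simps)
    also have "0 \<le> \<dots>" by simp
    finally have "u + u\<^sup>2 - u ^ 4 \<le> 2" by simp
    then show ?thesis using 1 d by simp
  next
    case 2
    have "u + u\<^sup>2 - u ^ 4 \<le> 0"
    proof (cases "\<bar>u\<bar> \<le> 1")
      case True
      have "u * (1 + u) \<le> 0" using 2 True by (intro mult_nonpos_nonneg) auto
      then have "u + u\<^sup>2 \<le> 0" by (simp add: power2_eq_square algebra_simps)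
      also have "0 \<le> u ^ 4" by simp
      finally show ?thesis by simp
    next
      case False
      then have "u\<^sup>2 \<le> u ^ 4" using power_increasing[of 2 4 "\<bar>u\<bar>"] by simp
      then show ?thesis using 2 by simp
    qed
    then show ?thesis using 2 d by simp
  next
    case 3
    then have "u\<^sup>2 \<le> u" using d by (simp add: power2_eq_square mult_left_le)
    moreover have "0 \<le> u ^ 4" by simp
    ultimately have "u + u\<^sup>2 - u ^ 4 \<le> 2 * d" using 3 by linarith
    then show ?thesis using 3 by simp
  qed
qed

text \<open>This plays the role of a Paley-Zygmund bound, but one-sided:
  \<open>quartic_le_indicator\<close> is applied to u = S / K and integrated. The mean of S is zero,
  the second moment is at least n / 24 and the fourth at most 3 n^2, so a positive constant remains
  on the left.\<close>

lemma (in prob_space) prob_centred_sum_gt: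
  fixes Y :: "'b \<Rightarrow> 'a \<Rightarrow> real"
  assumes I: "finite I" "I \<noteq> {}" and indep: "indep_vars (\<lambda>_. borel) Y I"
    and mean: "\<And>i. i \<in> I \<Longrightarrow> expectation (Y i) = 0"
    and bdd: "\<And>i. i \<in> I \<Longrightarrow> AE \<omega> in M. \<bar>Y i \<omega>\<bar> \<le> 1"
    and var: "\<And>i. i \<in> I \<Longrightarrow> 1 / 24 \<le> expectation (\<lambda>\<omega>. (Y i \<omega>)\<^sup>2)"
  shows "1 / 27648 \<le> prob {\<omega> \<in> space M. sqrt (card I) / 2304 < (\<Sum>i\<in>I. Y i \<omega>)}"
proof -
  define n where "n = real (card I)"
  define S where "S \<omega> = (\<Sum>i\<in>I. Y i \<omega>)" for \<omega>
  define K where "K = 12 * sqrt n"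
    \<comment> \<open>with \<open>K = k * sqrt n\<close>, the bound \<open>1 / (24 * k\<^sup>2) - 3 / k ^ 4\<close> used below is maximal at \<open>k = 12\<close>\<close>
  have n: "0 < n" using I by (simp add: n_def card_gt_0_iff)
  have K: "0 < K" "K\<^sup>2 = 144 * n" "K ^ 4 = 20736 * n\<^sup>2"
    using n by (auto simp: K_def power_mult_distrib power4_eq_xxxx power2_eq_square)
  note mom = indep_vars_centred_sum_moments[OF I(1) indep mean bdd, folded S_def n_def]
  have [measurable]: "random_variable borel (Y i)" if "i \<in> I" for i
    using indep that by (auto simp: indep_vars_def)
  have [measurable]: "S \<in> borel_measurable M" by (simp add: S_def[abs_def])
  have S2: "n / 24 \<le> expectation (\<lambda>\<omega>. (S \<omega>)\<^sup>2)"
    using mom sum_mono[of I "\<lambda>_. 1 / 24" "\<lambda>i. expectation (\<lambda>\<omega>. (Y i \<omega>)\<^sup>2)", OF var]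
    by (simp add: n_def)
  have intS: "integrable M (\<lambda>\<omega>. S \<omega> ^ k)" for k
  proof (rule integrable_const_bound)
    have "AE \<omega> in M. \<bar>S \<omega>\<bar> \<le> n" using mom by simp
    then show "AE \<omega> in M. norm (S \<omega> ^ k) \<le> n ^ k"
      by eventually_elim (auto simp: power_abs intro!: power_mono)
  qed simp
  \<comment> \<open>With K^2 = 144 n the left side is at least 1/3456 - 1/6912 = 1/6912. Taking d =
    1/27648, a quarter of this, lets the term 2 d use up half of it, and the other half gives 2 P(A)
    >= 1/13824. The threshold is d K = sqrt n / 2304.\<close>
  define A where "A = {\<omega> \<in> space M. sqrt n / 2304 < S \<omega>}"
  have [measurable]: "A \<in> events" unfolding A_def by measurable
  have intA: "integrable M (indicator A :: 'a \<Rightarrow> real)"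
    by (rule integrable_real_indicator) (auto simp: less_top[symmetric])
  have "1 / 6912 \<le> n / 24 / K\<^sup>2 - 3 * n\<^sup>2 / K ^ 4"
    using n by (simp add: K)
  also have "\<dots> \<le> expectation (\<lambda>\<omega>. (S \<omega>)\<^sup>2) / K\<^sup>2 - expectation (\<lambda>\<omega>. S \<omega> ^ 4) / K ^ 4"
    using mom S2 K(1) by (intro diff_mono divide_right_mono) auto
  also have "\<dots> = expectation (\<lambda>\<omega>. S \<omega> / K + (S \<omega> / K)\<^sup>2 - (S \<omega> / K) ^ 4)"
    using mom intS[of 1] intS[of 2] intS[of 4] by (simp add: power_divide)
  also have "\<dots> \<le> expectation (\<lambda>\<omega>. 2 * indicator A \<omega> + 2 * (1 / 27648))"
  proof (rule integral_mono)
    fix \<omega> assume "\<omega> \<in> space M"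
    moreover have "1 / 27648 < S \<omega> / K \<longleftrightarrow> sqrt n / 2304 < S \<omega>"
      using K(1) by (simp add: less_divide_eq) (simp add: K_def mult.commute)
    ultimately show "S \<omega> / K + (S \<omega> / K)\<^sup>2 - (S \<omega> / K) ^ 4 \<le> 2 * indicator A \<omega> + 2 * (1 / 27648)"
      using quartic_le_indicator[of "1 / 27648" "S \<omega> / K"] by (simp add: indicator_def A_def)
  next
    show "integrable M (\<lambda>\<omega>. S \<omega> / K + (S \<omega> / K)\<^sup>2 - (S \<omega> / K) ^ 4)"
      using intS[of 1] intS[of 2] intS[of 4] by (simp add: power_divide)
  qed (simp add: intA)
  also have "\<dots> = 2 * prob A + 2 * (1 / 27648)"
    by (simp add: prob_space intA)
  finally show ?thesis by (simp add: A_def n_def S_def)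
qed

section \<open>The sum statistic under a mixture hypothesis\<close>

text \<open>The uniform law is its own mixture with weight 0, so mean and Chebyshev bounds proved
  for the mixture hypothesis cover H_0 as well.\<close>

lemma null_hypothesis_imp_mixture_hypothesis:
  "null_hypothesis m \<zeta> P \<Longrightarrow> mixture_hypothesis m 0 (\<lambda>_. 1) \<zeta> P"
  by (simp add: null_hypothesis_def mixture_hypothesis_def mixture_uniform_0)

text \<open>The mean (1 - e) / 2 + e a / 2 is written as a shortfall from the null mean 1/2, so that
  the gap between the hypotheses can be read off.\<close>

definition mixture_mean :: "real \<Rightarrow> real \<Rightarrow> real" where
  "mixture_mean e a = 1 / 2 - e * (1 - a) / 2"

context
  fixes m :: nat and e :: real and \<pi> :: "nat \<Rightarrow> real" and \<zeta> :: "nat \<Rightarrow> 'a \<Rightarrow> real" and P :: "'a measure"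
  assumes hyp: "mixture_hypothesis m e \<pi> \<zeta> P"
    and e: "0 \<le> e" "e \<le> 1"
    and \<pi>: "\<And>t. t \<in> {1..m} \<Longrightarrow> 0 < \<pi> t \<and> \<pi> t \<le> 1"
begin

interpretation prob_space P
  using hyp by (simp add: mixture_hypothesis_def)

lemma observation_measurable: "t \<in> {1..m} \<Longrightarrow> \<zeta> t \<in> borel_measurable P"
  using hyp by (auto simp: mixture_hypothesis_def indep_vars_def)

lemma observation_distr: "t \<in> {1..m} \<Longrightarrow> distr P borel (\<zeta> t) = mixture e (uniform_on 1) (uniform_on (\<pi> t))"
  using hyp by (simp add: mixture_hypothesis_def)

lemma observation_bounded:
  assumes t: "t \<in> {1..m}"
  shows "AE \<omega> in P. 0 \<le> \<zeta> t \<omega> \<and> \<zeta> t \<omega> \<le> 1"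
proof -
  have "AE x in distr P borel (\<zeta> t). 0 \<le> x \<and> x \<le> 1"
    unfolding observation_distr[OF t] using e \<pi>[OF t] by (intro AE_mixture_uniform) auto
  then show ?thesis by (rule AE_distrD[OF observation_measurable[OF t]])
qed

lemma observation_moment:
  assumes t: "t \<in> {1..m}"
  shows "integrable P (\<lambda>\<omega>. \<zeta> t \<omega> ^ k)"
    and "expectation (\<lambda>\<omega>. \<zeta> t \<omega> ^ k) = (1 - e) / real (Suc k) + e * \<pi> t ^ k / real (Suc k)"
proof -
  have h: "has_bochner_integral (distr P borel (\<zeta> t)) (\<lambda>x. x ^ k)
      ((1 - e) / real (Suc k) + e * \<pi> t ^ k / real (Suc k))"
    unfolding observation_distr[OF t] using e \<pi>[OF t] by (intro has_bochner_integral_power_mixture) auto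
  note [measurable] = observation_measurable[OF t]
  show "integrable P (\<lambda>\<omega>. \<zeta> t \<omega> ^ k)"
    using h by (simp add: has_bochner_integral_iff integrable_distr_eq)
  show "expectation (\<lambda>\<omega>. \<zeta> t \<omega> ^ k) = (1 - e) / real (Suc k) + e * \<pi> t ^ k / real (Suc k)"
    using h by (simp add: has_bochner_integral_iff integral_distr)
qed

lemma expectation_observation:
  assumes "t \<in> {1..m}"
  shows "integrable P (\<zeta> t)" and "expectation (\<zeta> t) = mixture_mean e (\<pi> t)"
  using observation_moment[OF assms, of 1] by (simp_all add: mixture_mean_def field_simps)

lemma integral_sum_stat:
  "integrable P (sum_stat m \<zeta>)"
  "(\<integral>\<omega>. sum_stat m \<zeta> \<omega> \<partial>P) = (\<Sum>t=1..m. mixture_mean e (\<pi> t))"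
  using expectation_observation by (auto simp: sum_stat_def[abs_def] simp del: One_nat_def
    intro!: Bochner_Integration.integrable_sum)

lemma centred_observation:
  shows "indep_vars (\<lambda>_. borel) (\<lambda>t \<omega>. \<zeta> t \<omega> - mixture_mean e (\<pi> t)) {1..m}"
    and "t \<in> {1..m} \<Longrightarrow> expectation (\<lambda>\<omega>. \<zeta> t \<omega> - mixture_mean e (\<pi> t)) = 0"
    and "t \<in> {1..m} \<Longrightarrow> AE \<omega> in P. \<bar>\<zeta> t \<omega> - mixture_mean e (\<pi> t)\<bar> \<le> 1"
    and "t \<in> {1..m} \<Longrightarrow> 1 / 12 - e / 3 \<le> expectation (\<lambda>\<omega>. (\<zeta> t \<omega> - mixture_mean e (\<pi> t))\<^sup>2)"
proof -
  show "indep_vars (\<lambda>_. borel) (\<lambda>t \<omega>. \<zeta> t \<omega> - mixture_mean e (\<pi> t)) {1..m}"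
    using hyp by (intro indep_vars_compose2[where X = \<zeta> and Y = "\<lambda>t x. x - mixture_mean e (\<pi> t)"])
      (auto simp: mixture_hypothesis_def)
  assume t: "t \<in> {1..m}"
  have p: "0 \<le> e * (1 - \<pi> t)" "e * (1 - \<pi> t) \<le> 1"
    using e \<pi>[OF t] by (auto intro: mult_le_one)
  then have mu: "0 \<le> mixture_mean e (\<pi> t)" "mixture_mean e (\<pi> t) \<le> 1 / 2"
    by (auto simp: mixture_mean_def)
  show "expectation (\<lambda>\<omega>. \<zeta> t \<omega> - mixture_mean e (\<pi> t)) = 0"
    using expectation_observation[OF t] by (simp add: prob_space)
  show "AE \<omega> in P. \<bar>\<zeta> t \<omega> - mixture_mean e (\<pi> t)\<bar> \<le> 1"
    using observation_bounded[OF t] by eventually_elim (use mu in auto)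
  \<comment> \<open>The variance bound is uniform in \<pi>: the second moment is at least (1 - e) /
    3 once the term with \<pi>^2 is dropped, and the squared mean is at most 1/4.\<close>
  have "(mixture_mean e (\<pi> t))\<^sup>2 \<le> (1 / 2)\<^sup>2" using mu by (intro power_mono)
  moreover have "0 \<le> e * (\<pi> t)\<^sup>2" using e by simp
  ultimately have "1 / 12 - e / 3 \<le> (1 - e) / 3 + e * (\<pi> t)\<^sup>2 / 3 - (mixture_mean e (\<pi> t))\<^sup>2"
    unfolding diff_divide_distrib power_divide by simp
  also have "\<dots> = expectation (\<lambda>\<omega>. (\<zeta> t \<omega>)\<^sup>2) - (expectation (\<zeta> t))\<^sup>2"
    using observation_moment(2)[OF t, of 2] expectation_observation[OF t] by simp
  also have "\<dots> = expectation (\<lambda>\<omega>. (\<zeta> t \<omega> - expectation (\<zeta> t))\<^sup>2)"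
    using observation_moment(1)[OF t, of 2] expectation_observation(1)[OF t] by (subst variance_eq) auto
  finally show "1 / 12 - e / 3 \<le> expectation (\<lambda>\<omega>. (\<zeta> t \<omega> - mixture_mean e (\<pi> t))\<^sup>2)"
    by (simp add: expectation_observation[OF t])
qed

lemma sum_stat_centred:
  "(\<Sum>t=1..m. \<zeta> t \<omega> - mixture_mean e (\<pi> t)) = sum_stat m \<zeta> \<omega> - expectation (sum_stat m \<zeta>)"
  unfolding integral_sum_stat(2) by (simp add: sum_stat_def sum_subtractf)

text \<open>The centred observations are bounded by 1, so the variance of the sum is at most m,
  whatever e and \<pi> are.\<close>

lemma sum_stat_Chebyshev:
  assumes a: "0 < a"
  shows "prob {\<omega> \<in> space P. a \<le> \<bar>sum_stat m \<zeta> \<omega> - expectation (sum_stat m \<zeta>)\<bar>} \<le> m / a\<^sup>2"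
proof -
  have [measurable]: "sum_stat m \<zeta> \<in> borel_measurable P"
    using integral_sum_stat(1) by simp
  have bdd: "AE \<omega> in P. \<forall>t\<in>{1..m}. 0 \<le> \<zeta> t \<omega> \<and> \<zeta> t \<omega> \<le> 1"
    using observation_bounded by (intro AE_finite_allI) auto
  have "integrable P (\<lambda>\<omega>. (sum_stat m \<zeta> \<omega>)\<^sup>2)"
  proof (rule integrable_const_bound)
    show "AE \<omega> in P. norm ((sum_stat m \<zeta> \<omega>)\<^sup>2) \<le> (real m)\<^sup>2"
      using bdd
    proof eventually_elim
      case (elim \<omega>)
      then have "0 \<le> sum_stat m \<zeta> \<omega>" "sum_stat m \<zeta> \<omega> \<le> m"
        using sum_mono[of "{1..m}" "\<lambda>t. \<zeta> t \<omega>" "\<lambda>_. 1"] by (auto simp: sum_stat_def intro!: sum_nonneg)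
      then show ?case by (simp add: power_mono)
    qed
  qed measurable
  then have "prob {\<omega> \<in> space P. a \<le> \<bar>sum_stat m \<zeta> \<omega> - expectation (sum_stat m \<zeta>)\<bar>}
      \<le> variance (sum_stat m \<zeta>) / a\<^sup>2"
    using a by (intro Chebyshev_inequality) auto
  also have "variance (sum_stat m \<zeta>) \<le> m"
    using indep_vars_centred_sum_moments[OF _ centred_observation(1,2,3)]
    by (simp add: sum_stat_centred del: One_nat_def)
  finally show ?thesis using a by (simp add: divide_right_mono)
qed

text \<open>For e <= 1/8 the variance bound 1/12 - e/3 is at least 1/24, as
  \<open>prob_centred_sum_gt\<close> requires.\<close>

lemma sum_stat_anticoncentration:
  assumes "0 < m" "e \<le> 1 / 8"
  shows "1 / 27648 \<le> prob {\<omega> \<in> space P. expectation (sum_stat m \<zeta>) + sqrt m / 2304 < sum_stat m \<zeta> \<omega>}"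
proof -
  have "1 / 27648 \<le> prob {\<omega> \<in> space P. sqrt (card {1..m}) / 2304 < (\<Sum>t=1..m. \<zeta> t \<omega> - mixture_mean e (\<pi> t))}"
  proof (rule prob_centred_sum_gt[OF _ _ centred_observation(1,2,3)])
    show "1 / 24 \<le> expectation (\<lambda>\<omega>. (\<zeta> t \<omega> - mixture_mean e (\<pi> t))\<^sup>2)" if "t \<in> {1..m}" for t
      using centred_observation(4)[OF that] assms by simp
  qed (use assms in auto)
  then show ?thesis unfolding sum_stat_centred by (simp add: algebra_simps)
qed

end

section \<open>Asymptotics of the sum test on both sides of p + q = 1/2\<close>

theorem proposition3p6:
  fixes p q :: real
    and \<pi> :: "nat \<Rightarrow> nat \<Rightarrow> real"
    and \<zeta> :: "nat \<Rightarrow> nat \<Rightarrow> 'a \<Rightarrow> real"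
    and P0 P1 :: "nat \<Rightarrow> 'a measure"
  assumes "0 < p" "p < 1" "0 < q" "q < 1"
    and "\<And>m t. m \<ge> 2 \<Longrightarrow> t \<in> {1..m} \<Longrightarrow> 0 < \<pi> m t \<and> \<pi> m t \<le> 1"
    and "\<And>m. m \<ge> 2 \<Longrightarrow> null_hypothesis m (\<zeta> m) (P0 m)"
    and "\<And>m. m \<ge> 2 \<Longrightarrow> mixture_hypothesis m (real m powr (- p)) (\<pi> m) (\<zeta> m) (P1 m)"
  shows
    "(q + p < 1 / 2 \<and> (\<forall>m\<ge>2. \<forall>t\<in>{1..m}. \<pi> m t \<le> 1 - real m powr (- q)) \<longrightarrow>
        (let c = (\<lambda>m. (\<integral>\<omega>. sum_stat m (\<zeta> m) \<omega> \<partial>P0 m) - real m powr (1 - (p + q)) / 4)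
         in (\<lambda>m. type_I_error (P0 m) (sum_test_rejects m (\<zeta> m) (c m)) +
                 type_II_error (P1 m) (sum_test_rejects m (\<zeta> m) (c m))) \<longlonglongrightarrow> 0))
     \<and>
     (q + p > 1 / 2 \<and> (\<forall>m\<ge>2. \<forall>t\<in>{1..m}. \<pi> m t \<ge> 1 - real m powr (- q)) \<longrightarrow>
        (\<forall>c :: nat \<Rightarrow> real.
           (\<forall>m\<ge>2. (\<integral>\<omega>. sum_stat m (\<zeta> m) \<omega> \<partial>P1 m) \<le> c m \<and>
                   c m \<le> (\<integral>\<omega>. sum_stat m (\<zeta> m) \<omega> \<partial>P0 m)) \<longrightarrow>
           limsup (\<lambda>m. ereal (test_power (P1 m) (sum_test_rejects m (\<zeta> m) (c m)))) < 1))"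
proof -
  have \<epsilon>: "0 \<le> real m powr (- p)" "real m powr (- p) \<le> 1" if "2 \<le> m" for m
    using that \<open>0 < p\<close> powr_mono[of "- p" 0 "real m"] by auto
  note H0 = null_hypothesis_imp_mixture_hypothesis[OF assms(6)]
  note H1 = assms(7)
  define s where "s m = sum_stat m (\<zeta> m)" for m
  define E0 where "E0 m = (\<integral>\<omega>. s m \<omega> \<partial>P0 m)" for m
  define E1 where "E1 m = (\<integral>\<omega>. s m \<omega> \<partial>P1 m)" for m
  have gap: "E0 m - E1 m = (\<Sum>t=1..m. real m powr (- p) * (1 - \<pi> m t) / 2)" if "2 \<le> m" for m
    using integral_sum_stat(2)[OF H0[OF that]] integral_sum_stat(2)[OF H1[OF that] \<epsilon>[OF that] assms(5)[OF that]]
    by (simp add: E0_def E1_def s_def mixture_mean_def sum_subtractf del: One_nat_def)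
  \<comment> \<open>This is the gap in the boundary case where every \<pi> equals 1 - m^(-q). Both
    parts compare the actual gap with it term by term, in opposite directions.\<close>
  have gap_const: "(\<Sum>t=1..m. real m powr (- p) * real m powr (- q) / 2) = real m powr (1 - (p + q)) / 2"
    if "2 \<le> m" for m
    using that by (simp add: powr_add powr_diff powr_minus field_simps)
  have meas [measurable]: "s m \<in> borel_measurable (P0 m)" "s m \<in> borel_measurable (P1 m)" if "2 \<le> m" for m
    using integral_sum_stat(1)[OF H0[OF that]] integral_sum_stat(1)[OF H1[OF that] \<epsilon>[OF that] assms(5)[OF that]]
    by (auto simp: s_def)
  have prob: "prob_space (P0 m)" "prob_space (P1 m)" if "2 \<le> m" for m
    using H0[OF that] H1[OF that] by (auto simp: mixture_hypothesis_def)

  have part1: "(\<lambda>m. type_I_error (P0 m) (sum_test_rejects m (\<zeta> m) (E0 m - real m powr (1 - (p + q)) / 4)) +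
         type_II_error (P1 m) (sum_test_rejects m (\<zeta> m) (E0 m - real m powr (1 - (p + q)) / 4)))
       \<longlonglongrightarrow> 0" (is "?err \<longlonglongrightarrow> 0")
    if pq: "q + p < 1 / 2" and le: "\<And>m t. 2 \<le> m \<Longrightarrow> t \<in> {1..m} \<Longrightarrow> \<pi> m t \<le> 1 - real m powr (- q)"
  proof (rule tendsto_sandwich)
    show "\<forall>\<^sub>F m in sequentially. 0 \<le> ?err m"
      by (auto simp: type_I_error_def type_II_error_def)
    \<comment> \<open>Each of the two errors contributes m / a^2 = 16 m^(2(p+q) - 1), where a =
      m^(1-(p+q)) / 4. The exponent is negative since p + q < 1/2.\<close>
    show "(\<lambda>m. 32 * real m powr (2 * (p + q) - 1)) \<longlonglongrightarrow> 0"
      using pq by real_asymp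
    show "\<forall>\<^sub>F m in sequentially. ?err m \<le> 32 * real m powr (2 * (p + q) - 1)"
      using eventually_ge_at_top[of 2]
    proof eventually_elim
      case (elim m)
      interpret P0: prob_space "P0 m" by (rule prob(1)[OF elim])
      interpret P1: prob_space "P1 m" by (rule prob(2)[OF elim])
      note [measurable] = meas[OF elim]
      \<comment> \<open>The gap is at least 2 a, so the critical value E0 - a lies at distance at
        least a from both means and either error forces a deviation of at least a.\<close>
      define a where "a = real m powr (1 - (p + q)) / 4"
      have a: "0 < a" using elim by (simp add: a_def)
      have a2: "a\<^sup>2 = real m powr (2 * (1 - (p + q))) / 16"
        by (simp add: a_def power_divide power2_eq_square algebra_simps flip: powr_add)
      have "real m / a\<^sup>2 = 16 * (real m powr 1 / real m powr (2 * (1 - (p + q))))"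
        unfolding a2 by simp
      also have "\<dots> = 16 * real m powr (1 - 2 * (1 - (p + q)))"
        by (simp only: powr_diff)
      also have "1 - 2 * (1 - (p + q)) = 2 * (p + q) - 1" by simp
      finally have ma: "real m / a\<^sup>2 = 16 * real m powr (2 * (p + q) - 1)" .
      have "2 * a = (\<Sum>t=1..m. real m powr (- p) * real m powr (- q) / 2)"
        unfolding gap_const[OF elim] a_def by simp
      also have "\<dots> \<le> E0 m - E1 m"
        unfolding gap[OF elim]
      proof (intro sum_mono divide_right_mono mult_left_mono)
        show "real m powr - q \<le> 1 - \<pi> m t" if "t \<in> {1..m}" for t
          using le[OF elim that] by simp
      qed auto
      finally have "2 * a \<le> E0 m - E1 m" .
      then have "{\<omega> \<in> space (P1 m). \<not> s m \<omega> \<le> E0 m - a} \<subseteq> {\<omega> \<in> space (P1 m). a \<le> \<bar>s m \<omega> - E1 m\<bar>}"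
        by auto
      then have "P1.prob {\<omega> \<in> space (P1 m). \<not> s m \<omega> \<le> E0 m - a} \<le> P1.prob {\<omega> \<in> space (P1 m). a \<le> \<bar>s m \<omega> - E1 m\<bar>}"
        by (intro P1.finite_measure_mono) measurable
      also have "\<dots> \<le> m / a\<^sup>2"
        using sum_stat_Chebyshev[OF H1[OF elim] \<epsilon>[OF elim] assms(5)[OF elim] a] by (simp add: s_def E1_def)
      finally have II: "P1.prob {\<omega> \<in> space (P1 m). \<not> s m \<omega> \<le> E0 m - a} \<le> m / a\<^sup>2" .
      have "P0.prob {\<omega> \<in> space (P0 m). s m \<omega> \<le> E0 m - a} \<le> P0.prob {\<omega> \<in> space (P0 m). a \<le> \<bar>s m \<omega> - E0 m\<bar>}"
        by (rule P0.finite_measure_mono[rotated], measurable) auto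
      also have "\<dots> \<le> m / a\<^sup>2"
        using sum_stat_Chebyshev[OF H0[OF elim] _ _ _ a] by (simp add: s_def E0_def)
      finally have I: "P0.prob {\<omega> \<in> space (P0 m). s m \<omega> \<le> E0 m - a} \<le> m / a\<^sup>2" .
      show ?case
        using add_mono[OF I II] unfolding ma
        by (simp add: type_I_error_def type_II_error_def sum_test_rejects_def a_def s_def)
    qed
  qed simp

  have part2: "limsup (\<lambda>m. ereal (test_power (P1 m) (sum_test_rejects m (\<zeta> m) (c m)))) < 1"
    if pq: "1 / 2 < q + p" and ge: "\<And>m t. 2 \<le> m \<Longrightarrow> t \<in> {1..m} \<Longrightarrow> 1 - real m powr (- q) \<le> \<pi> m t"
      and c: "\<And>m. 2 \<le> m \<Longrightarrow> c m \<le> E0 m" for c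
  proof -
    \<comment> \<open>Since 1 - (p + q) < 1/2, the gap eventually fits below the deviation sqrt m /
      2304 that \<open>sum_stat_anticoncentration\<close> guarantees with probability at least
      1/27648.\<close>
    have "\<forall>\<^sub>F m in sequentially. real m powr (1 - (p + q)) / 2 \<le> sqrt m / 2304"
      using pq by real_asymp
    moreover have "\<forall>\<^sub>F m in sequentially. real m powr (- p) \<le> 1 / 8"
      using \<open>0 < p\<close> by real_asymp
    ultimately have "\<forall>\<^sub>F m in sequentially.
        ereal (test_power (P1 m) (sum_test_rejects m (\<zeta> m) (c m))) \<le> ereal (1 - 1 / 27648)"
      using eventually_ge_at_top[of 2]
    proof eventually_elim
      case (elim m)
      interpret P1: prob_space "P1 m" by (rule prob(2)[OF elim(3)])
      note [measurable] = meas[OF elim(3)]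
      have "E0 m - E1 m \<le> real m powr (1 - (p + q)) / 2"
        unfolding gap[OF elim(3)] gap_const[OF elim(3), symmetric]
      proof (intro sum_mono divide_right_mono mult_left_mono)
        show "1 - \<pi> m t \<le> real m powr - q" if "t \<in> {1..m}" for t
          using ge[OF elim(3) that] by simp
      qed auto
      \<comment> \<open>Even the critical value E0 stays below this deviation above E1, so the upper
        tail event lies inside the event of not rejecting.\<close>
      then have "c m \<le> E1 m + sqrt m / 2304" using c[OF elim(3)] elim(1) by simp
      then have "{\<omega> \<in> space (P1 m). E1 m + sqrt m / 2304 < s m \<omega>} \<subseteq> {\<omega> \<in> space (P1 m). \<not> s m \<omega> \<le> c m}"
        by auto
      then have "P1.prob {\<omega> \<in> space (P1 m). E1 m + sqrt m / 2304 < s m \<omega>} \<le> P1.prob {\<omega> \<in> space (P1 m). \<not> s m \<omega> \<le> c m}"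
        by (rule P1.finite_measure_mono) measurable
      moreover have "1 / 27648 \<le> P1.prob {\<omega> \<in> space (P1 m). E1 m + sqrt m / 2304 < s m \<omega>}"
        using sum_stat_anticoncentration[OF H1[OF elim(3)] \<epsilon>[OF elim(3)] assms(5)[OF elim(3)] _ elim(2)] elim(3)
        by (simp add: s_def E1_def)
      ultimately show ?case
        by (simp add: test_power_def type_II_error_def sum_test_rejects_def s_def)
    qed
    then have "limsup (\<lambda>m. ereal (test_power (P1 m) (sum_test_rejects m (\<zeta> m) (c m)))) \<le> ereal (1 - 1 / 27648)"
      by (rule Limsup_bounded)
    also have "\<dots> < 1" by simp
    finally show ?thesis .
  qed
  show ?thesis
    \<comment> \<open>The reversed definition folds the null expectations in the goal back into
      \<open>E0\<close>.\<close>
    unfolding Let_def E0_def[unfolded s_def, symmetric]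
  proof (intro conjI impI allI)
    assume "q + p < 1 / 2 \<and> (\<forall>m\<ge>2. \<forall>t\<in>{1..m}. \<pi> m t \<le> 1 - real m powr (- q))"
    then show "?err \<longlonglongrightarrow> 0" by (intro part1) auto
  next
    fix c
    assume "q + p > 1 / 2 \<and> (\<forall>m\<ge>2. \<forall>t\<in>{1..m}. \<pi> m t \<ge> 1 - real m powr (- q))"
      and "\<forall>m\<ge>2. (\<integral>\<omega>. sum_stat m (\<zeta> m) \<omega> \<partial>P1 m) \<le> c m \<and> c m \<le> E0 m"
    then show "limsup (\<lambda>m. ereal (test_power (P1 m) (sum_test_rejects m (\<zeta> m) (c m)))) < 1"
      by (intro part2) auto
  qed
qed

end
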